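(* Let $(C,\tau^C)$ and $(\Theta,\tau^\Theta)$ be (non-empty) compact Hausdorff spaces, let $U:\Theta\times C\to\mathbb{R}$ be jointly continuous and let $V:\Theta\times C\to\mathbb{R}$ be jointly upper semicontinuous. Let $\underline{u}:\Theta\to\mathbb{R}$ be a function for which there exists $c^*\in C$ with $U(\theta,c^* )\ge \underline{u}(\theta)$ for all $\theta\in\Theta$. Let $\mathbb{K}$ be a non-empty set of regular Borel probability measures on $\Theta$ and let $\alpha:\mathbb{K}\to\mathbb{R}$ be a function. Then the problem $$\sup_{D\in T}\ \inf_{\kappa\in\mathbb{K}}\left\{\int_\Theta V^*(\theta,D)\,d\kappa(\theta)+\alpha(\kappa)\right\}$$ admits an optimal solution, i.e. there is $D^*\in T$ at which the supremum is attained.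
   Context: $\mathrm{CL}(C)$ denotes the family of all non-empty closed subsets of $C$ (called menus). For $\theta\in\Theta$, $D\in\mathrm{CL}(C)$ put $$U^*(\theta,D):=\sup_{d\in D}U(\theta,d),\qquad \Phi(\theta,D):=\operatorname*{arg\,max}_{d\in D}U(\theta,d),\qquad V^*(\theta,D):=\sup_{d\in\Phi(\theta,D)}V(\theta,d).$$ The set of individually rational menus is $$T:=\{D\in\mathrm{CL}(C): U^*(\theta,D)\ge\underline{u}(\theta)\ \text{for all }\theta\in\Theta\}.$$ Here $C$ is the contract space, $\Theta$ the type space, $U$ and $V$ the agent's and principal's utilities, $\underline{u}$ the reservation utility, $\mathbb{K}$ the principal's set of beliefs and $\alpha$ a penalty function. The spaces need not be metrizable. Integrals of functions bounded above and infima are taken with values in $[-\infty,\infty)$. *)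

theory Defs
  imports "HOL-Probability.Probability"
begin

definition usc :: "('a::topological_space \<Rightarrow> real) \<Rightarrow> bool" where
  "usc f \<longleftrightarrow> (\<forall>a. open {x. f x < a})"

definition regular_borel_prob :: "'a::topological_space measure \<Rightarrow> bool" where
  "regular_borel_prob M \<longleftrightarrow>
     prob_space M \<and> sets M = sets borel \<and>
     (\<forall>A\<in>sets M.
        emeasure M A = (SUP K\<in>{K. K \<subseteq> A \<and> compact K}. emeasure M K) \<and>
        emeasure M A = (INF W\<in>{W. A \<subseteq> W \<and> open W}. emeasure M W))"

(* Integral of the positive part minus integral of the negative part. ennreal clips negative
   reals to 0. For f bounded above and M finite the first term is finite, so the
   case \<infinity> - \<infinity> does not occur and the value lies in [-\<infinity>, \<infinity>). The Bochner integral would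
   give 0 instead of -\<infinity> for a non-integrable f. *)
definition ext_integral :: "'a measure \<Rightarrow> ('a \<Rightarrow> real) \<Rightarrow> ereal" where
  "ext_integral M f =
     enn2ereal (\<integral>\<^sup>+x. ennreal (f x) \<partial>M) - enn2ereal (\<integral>\<^sup>+x. ennreal (- f x) \<partial>M)"

definition menus :: "'c::topological_space set set" where
  "menus = {D. closed D \<and> D \<noteq> {}}"

(* The real-valued suprema below are over non-empty sets bounded above whenever D is a menu of
   a compact space, U is jointly continuous and V is jointly upper semicontinuous. *)
definition agent_value :: "('t \<Rightarrow> 'c \<Rightarrow> real) \<Rightarrow> 't \<Rightarrow> 'c set \<Rightarrow> real" where
  "agent_value U \<theta> D = (SUP d\<in>D. U \<theta> d)"

definition agent_choice :: "('t \<Rightarrow> 'c \<Rightarrow> real) \<Rightarrow> 't \<Rightarrow> 'c set \<Rightarrow> 'c set" where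
  "agent_choice U \<theta> D = {d. is_arg_max (U \<theta>) (\<lambda>d. d \<in> D) d}"

definition principal_value ::
    "('t \<Rightarrow> 'c \<Rightarrow> real) \<Rightarrow> ('t \<Rightarrow> 'c \<Rightarrow> real) \<Rightarrow> 't \<Rightarrow> 'c set \<Rightarrow> real" where
  "principal_value U V \<theta> D = (SUP d\<in>agent_choice U \<theta> D. V \<theta> d)"

definition ir_menus :: "('t \<Rightarrow> 'c::topological_space \<Rightarrow> real) \<Rightarrow> ('t \<Rightarrow> real) \<Rightarrow> 'c set set" where
  "ir_menus U u = {D \<in> menus. \<forall>\<theta>. agent_value U \<theta> D \<ge> u \<theta>}"

definition robust_payoff ::
    "('t \<Rightarrow> 'c \<Rightarrow> real) \<Rightarrow> ('t \<Rightarrow> 'c \<Rightarrow> real) \<Rightarrow> 't measure set \<Rightarrow> ('t measure \<Rightarrow> real)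
      \<Rightarrow> 'c set \<Rightarrow> ereal" where
  "robust_payoff U V \<K> \<alpha> D =
     (INF \<kappa>\<in>\<K>. ext_integral \<kappa> (\<lambda>\<theta>. principal_value U V \<theta> D) + ereal (\<alpha> \<kappa>))"

end

theory Submission
  imports Defs
begin

text \<open>The payoff is upper semicontinuous in the Vietoris sense: near a menu \<open>D\<close> and a type \<open>\<theta>\<close> the
  principal's value exceeds \<open>V\<^sup>*(\<theta>, D)\<close> by arbitrarily little, and inner regularity carries this over
  to the integrals. Since the space of closed subsets of a compact space is compact, a maximizing
  sequence of menus converges along an ultrafilter finer than \<open>sequentially\<close> (in a non-metrizable
  space no subsequence need converge), and the limit menu is individually rational and optimal.\<close>

section \<open>Ultrafilters and a local-to-global principle for compact sets\<close>

text \<open>Zorn's lemma on the proper filters below \<open>F\<close>. The order is reversed, so a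
  maximal element is a finest proper filter, and such a filter decides every predicate.\<close>

lemma ultrafilter_below:
  fixes F :: "'a filter"
  assumes "F \<noteq> bot"
  obtains G where "G \<le> F" "G \<noteq> bot" "\<And>P. eventually P G \<or> eventually (\<lambda>x. \<not> P x) G"
proof -
  let ?A = "{G. G \<le> F \<and> G \<noteq> bot}" and ?P = "\<lambda>G H :: 'a filter. H \<le> G"
  have "\<exists>m\<in>?A. \<forall>G\<in>?A. ?P m G \<longrightarrow> G = m"
  proof (rule predicate_Zorn)
    show "partial_order_on ?A (relation_of ?P ?A)"
      by (rule partial_order_on_relation_ofI) auto
    show "\<exists>u\<in>?A. \<forall>a\<in>C. ?P a u" if C: "C \<in> Chains (relation_of ?P ?A)" for C
    proof (cases "C = {}")
      case True
      then show ?thesis using assms by auto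
    next
      case False
      have sub: "C \<subseteq> ?A" and tot: "\<And>G H. G \<in> C \<Longrightarrow> H \<in> C \<Longrightarrow> G \<le> H \<or> H \<le> G"
        using C unfolding Chains_def relation_of_def by auto
      \<comment> \<open>The chain is a filter base: what holds eventually along its infimum already
        holds along a member. So the infimum is proper because the members are.\<close>
      have "eventually P (Inf C) \<longleftrightarrow> (\<exists>b\<in>C. eventually P b)" for P
      proof (rule eventually_Inf_base[OF False])
        fix G H assume "G \<in> C" "H \<in> C"
        then show "\<exists>x\<in>C. x \<le> inf G H"
          using tot[of G H] by (auto simp: le_inf_iff)
      qed
      then have "Inf C \<noteq> bot"
        using sub by (auto simp: trivial_limit_def)
      moreover have "Inf C \<le> F"
        using False sub by (auto intro: Inf_lower2)
      ultimately show ?thesis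
        by (intro bexI[of _ "Inf C"]) (auto intro: Inf_lower)
    qed
  qed
  then obtain G where G: "G \<le> F" "G \<noteq> bot"
    and max: "\<And>H. H \<le> F \<Longrightarrow> H \<noteq> bot \<Longrightarrow> H \<le> G \<Longrightarrow> H = G"
    by auto
  have "eventually (\<lambda>x. \<not> P x) G" if nP: "\<not> eventually P G" for P
  proof -
    \<comment> \<open>\<open>?H\<close> is proper precisely because \<open>P\<close> is not eventual
      along \<open>G\<close>; minimality then gives \<open>?H = G\<close>.\<close>
    let ?H = "inf G (principal {x. \<not> P x})"
    have "?H \<noteq> bot"
      using nP by (simp add: trivial_limit_def eventually_inf_principal)
    then have "?H = G"
      using G(1) by (intro max) (auto intro: le_infI1)
    moreover have "eventually (\<lambda>x. \<not> P x) ?H"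
      by (simp add: eventually_inf_principal)
    ultimately show ?thesis by simp
  qed
  with G show thesis by (intro that) auto
qed

text \<open>A finite subcover by good neighbourhoods, glued by \<open>Un\<close>. All later passages
  from local to uniform statements go through this rule, with \<open>P\<close> depending on the
  use.\<close>

lemma compact_neighbourhood_induct:
  assumes "compact K"
    and empty: "P {}"
    and Un: "\<And>A B. P A \<Longrightarrow> P B \<Longrightarrow> P (A \<union> B)"
    and loc: "\<And>x. x \<in> K \<Longrightarrow> \<exists>W. open W \<and> x \<in> W \<and> P W"
  obtains W where "open W" "K \<subseteq> W" "P W"
proof -
  from loc obtain N where N: "\<And>x. x \<in> K \<Longrightarrow> open (N x) \<and> x \<in> N x \<and> P (N x)"
    by metis
  then obtain X where X: "X \<subseteq> K" "finite X" "K \<subseteq> (\<Union>x\<in>X. N x)"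
    by (elim compactE_image[OF assms(1), of K N, rotated -1]) auto
  from X(2,1) have "P (\<Union>x\<in>X. N x)"
    by (induction rule: finite_induct) (use N in \<open>auto intro: empty Un\<close>)
  with X N show thesis
    by (intro that[of "\<Union>x\<in>X. N x"]) auto
qed

section \<open>Vietoris limits of sets\<close>

text \<open>The two clauses test convergence on the two kinds of subbasic Vietoris open sets: the
  upper half (containment in \<open>W\<close>) and the lower half (meeting
  \<open>W\<close>).\<close>

definition vietoris_limit :: "'a filter \<Rightarrow> ('a \<Rightarrow> 'c::topological_space set) \<Rightarrow> 'c set \<Rightarrow> bool" where
  "vietoris_limit F X D \<longleftrightarrow>
     (\<forall>W. open W \<longrightarrow> D \<subseteq> W \<longrightarrow> (\<forall>\<^sub>F n in F. X n \<subseteq> W)) \<and>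
     (\<forall>W. open W \<longrightarrow> D \<inter> W \<noteq> {} \<longrightarrow> (\<forall>\<^sub>F n in F. X n \<inter> W \<noteq> {}))"

lemma vietoris_limit_const: "vietoris_limit F (\<lambda>_. D) D"
  by (simp add: vietoris_limit_def)

text \<open>The limit consists of the points all of whose neighbourhoods are eventually met. The
  lower half is then immediate; the upper half comes from compactness of complements.\<close>

lemma vietoris_limit_exists:
  fixes X :: "'a \<Rightarrow> 'c::topological_space set"
  assumes cpt: "compact (UNIV :: 'c set)"
    and "F \<noteq> bot"
    and ultra: "\<And>P. eventually P F \<or> eventually (\<lambda>n. \<not> P n) F"
    and X: "\<And>n. X n \<noteq> {}"
  obtains D where "D \<in> menus" "vietoris_limit F X D"
proof -
  define D where "D = {c. \<forall>W. open W \<longrightarrow> c \<in> W \<longrightarrow> (\<forall>\<^sub>F n in F. X n \<inter> W \<noteq> {})}"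
  have "- D = \<Union>{W. open W \<and> \<not> (\<forall>\<^sub>F n in F. X n \<inter> W \<noteq> {})}"
    by (auto simp: D_def)
  then have closed: "closed D"
    unfolding closed_def by auto
  have upper: "\<forall>\<^sub>F n in F. X n \<subseteq> W" if W: "open W" "D \<subseteq> W" for W
  proof -
    have "compact (- W)"
      using closed_Int_compact[of "- W" UNIV] cpt W(1) by auto
    then obtain W' where "- W \<subseteq> W'" "\<forall>\<^sub>F n in F. X n \<inter> W' = {}"
    proof (rule compact_neighbourhood_induct)
      show "\<forall>\<^sub>F n in F. X n \<inter> (A \<union> B) = {}"
        if "\<forall>\<^sub>F n in F. X n \<inter> A = {}" "\<forall>\<^sub>F n in F. X n \<inter> B = {}" for A B
        using that by eventually_elim auto
      show "\<exists>W. open W \<and> x \<in> W \<and> (\<forall>\<^sub>F n in F. X n \<inter> W = {})" if "x \<in> - W" for x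
      proof -
        have "x \<notin> D" using that W(2) by blast
        then obtain O' where "open O'" "x \<in> O'" "\<not> (\<forall>\<^sub>F n in F. X n \<inter> O' \<noteq> {})"
          by (auto simp: D_def)
        \<comment> \<open>Along an ultrafilter, not being eventually met means being eventually
          missed.\<close>
        moreover from this have "\<forall>\<^sub>F n in F. X n \<inter> O' = {}"
          using ultra[of "\<lambda>n. X n \<inter> O' \<noteq> {}"] by simp
        ultimately show ?thesis by blast
      qed
    qed auto
    then show ?thesis
      by (auto elim!: eventually_mono)
  qed
  have "D \<noteq> {}"
    \<comment> \<open>If \<open>D\<close> were empty, the upper half with \<open>W = {}\<close>
      would make \<open>X n\<close> eventually empty.\<close>
    using upper[of "{}"] X \<open>F \<noteq> bot\<close> by auto
  with closed have "D \<in> menus" by (simp add: menus_def)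
  moreover have "vietoris_limit F X D"
    using upper unfolding vietoris_limit_def D_def by blast
  ultimately show thesis by (rule that)
qed

section \<open>Integration against regular measures\<close>

lemma regular_borel_prob_inner_compact:
  assumes reg: "regular_borel_prob M" and A: "A \<in> sets M" and e: "e > 0"
  obtains K where "compact K" "K \<subseteq> A" "measure M K \<ge> measure M A - e"
proof -
  interpret prob_space M using reg by (simp add: regular_borel_prob_def)
  show thesis
  \<comment> \<open>\<open>ennreal\<close> clips negative reals to 0, which would spoil the strict
    inequality for a null set \<open>A\<close>.\<close>
  proof (cases "measure M A - e < 0")
    case True
    then show ?thesis using that[of "{}"] by simp
  next
    case False
    have "ennreal (measure M A - e) < emeasure M A"
      using e False by (simp add: emeasure_eq_measure ennreal_lessI)
    also have "\<dots> = (SUP K\<in>{K. K \<subseteq> A \<and> compact K}. emeasure M K)"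
      using reg A by (simp add: regular_borel_prob_def)
    finally obtain K where "K \<subseteq> A" "compact K" "ennreal (measure M A - e) < emeasure M K"
      by (auto simp: less_SUP_iff)
    then show ?thesis
      by (intro that[of K]) (use False in \<open>auto simp: emeasure_eq_measure ennreal_less_iff\<close>)
  qed
qed

text \<open>This replaces Fatou's lemma, which fails along general filters. Inner regularity turns a simple
  minorant of \<open>h\<close> into one supported on finitely many compact sets, on each of which the local
  lower bounds are uniform.\<close>
lemma eventually_less_nn_integral:
  fixes M :: "'t::t2_space measure"
  assumes reg: "regular_borel_prob M"
    and loc: "\<And>x a. a < h x \<Longrightarrow> \<exists>W. open W \<and> x \<in> W \<and> (\<forall>\<^sub>F n in F. \<forall>y\<in>W. a \<le> k n y)"
    and c: "c < (\<integral>\<^sup>+x. h x \<partial>M)"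
  shows "\<forall>\<^sub>F n in F. c < (\<integral>\<^sup>+x. k n x \<partial>M)"
proof -
  interpret prob_space M using reg by (simp add: regular_borel_prob_def)
  have sets: "sets M = sets borel" using reg by (simp add: regular_borel_prob_def)
  from c obtain s where s: "simple_function M s" "s \<le> h" "\<And>x. s x < top" "c < integral\<^sup>S M s"
    unfolding nn_integral_def_finite by (auto simp: less_SUP_iff)
  define Y where "Y = s ` space M"
  define A where "A = (\<lambda>y. s -` {y} \<inter> space M)"
  \<comment> \<open>\<open>r e\<close> is the integral of \<open>s\<close> after lowering each value
    and the measure of each level set by \<open>e\<close>, truncated at 0. It is continuous with
    \<open>r 0\<close> the integral of \<open>s\<close>, so some \<open>e > 0\<close> still beats
    \<open>c\<close>.\<close>
  define r where "r = (\<lambda>e. \<Sum>y\<in>Y. max 0 (enn2real y - e) * max 0 (measure M (A y) - e))"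
  have fin: "finite Y" and A: "A y \<in> sets M" for y
    using simple_functionD[OF s(1)] by (auto simp: Y_def A_def)
  have Ytop: "y < top" if "y \<in> Y" for y using that s(3) by (auto simp: Y_def)
  have "integral\<^sup>S M s = (\<Sum>y\<in>Y. y * ennreal (measure M (A y)))"
    by (simp add: simple_integral_def Y_def A_def emeasure_eq_measure)
  also have "\<dots> = (\<Sum>y\<in>Y. ennreal (enn2real y * measure M (A y)))"
    using Ytop by (intro sum.cong) (auto simp: ennreal_mult)
  also have "\<dots> = ennreal (r 0)"
    by (simp add: r_def)
  finally have c0: "c < ennreal (r 0)" using s(4) by simp
  have "(r \<longlongrightarrow> r 0) (at_right 0)"
    unfolding r_def by (intro tendsto_intros)
  then have "((\<lambda>e. ennreal (r e)) \<longlongrightarrow> ennreal (r 0)) (at_right 0)"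
    by (rule tendsto_ennrealI)
  then have "\<forall>\<^sub>F e in at_right 0. c < ennreal (r e) \<and> e > 0"
    by (intro eventually_conj order_tendstoD(1)[OF _ c0] eventually_at_right_less)
  then obtain e where e: "c < ennreal (r e)" "e > 0"
    using eventually_happens'[of "at_right (0::real)"] by auto
  have "\<forall>y. \<exists>K. compact K \<and> K \<subseteq> A y \<and> measure M K \<ge> measure M (A y) - e"
    using regular_borel_prob_inner_compact[OF reg A e(2)] by metis
  then obtain K where K: "\<And>y. compact (K y)" "\<And>y. K y \<subseteq> A y"
      "\<And>y. measure M (K y) \<ge> measure M (A y) - e"
    by metis
  have Kset[measurable]: "K y \<in> sets M" for y
    using K(1) by (simp add: sets compact_imp_closed)
  define z where "z = (\<lambda>y. ennreal (max 0 (enn2real y - e)))"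
  have "\<forall>\<^sub>F n in F. \<forall>x\<in>K y. z y \<le> k n x" if y: "y \<in> Y" for y
  proof (cases "enn2real y - e \<le> 0")
    case True
    then show ?thesis by (simp add: z_def max_absorb1 ennreal_neg)
  next
    case False
    \<comment> \<open>The lowered value lies strictly below \<open>y\<close>, as \<open>loc\<close>
      demands; in the other case \<open>z y\<close> is 0 and the bound is trivial.\<close>
    have "z y < ennreal (enn2real y)"
      unfolding z_def by (rule ennreal_lessI) (use False e(2) in auto)
    then have zy: "z y < y" using Ytop[OF y] by simp
    obtain W where "K y \<subseteq> W" "\<forall>\<^sub>F n in F. \<forall>x\<in>W. z y \<le> k n x"
    proof (rule compact_neighbourhood_induct[OF K(1)[of y]])
      show "\<forall>\<^sub>F n in F. \<forall>x\<in>B \<union> C. z y \<le> k n x"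
        if "\<forall>\<^sub>F n in F. \<forall>x\<in>B. z y \<le> k n x" "\<forall>\<^sub>F n in F. \<forall>x\<in>C. z y \<le> k n x" for B C
        using that by eventually_elim auto
      fix x assume "x \<in> K y"
      then have "s x = y" using K(2)[of y] by (auto simp: A_def)
      then have "z y < h x" using zy s(2) by (auto simp: le_fun_def intro: less_le_trans)
      then show "\<exists>W. open W \<and> x \<in> W \<and> (\<forall>\<^sub>F n in F. \<forall>x\<in>W. z y \<le> k n x)" by (rule loc)
    qed auto
    then show ?thesis by (auto elim!: eventually_mono)
  qed
  then have "\<forall>\<^sub>F n in F. \<forall>y\<in>Y. \<forall>x\<in>K y. z y \<le> k n x"
    using fin by (simp add: eventually_ball_finite_distrib)
  then show ?thesis
  proof eventually_elim
    case (elim n)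
    have "ennreal (r e) \<le> (\<Sum>y\<in>Y. z y * emeasure M (K y))"
      unfolding r_def z_def emeasure_eq_measure
      using K(3) by (subst sum_ennreal[symmetric])
        (auto simp: ennreal_mult intro!: sum_mono mult_left_mono)
    also have "\<dots> = (\<integral>\<^sup>+x. (\<Sum>y\<in>Y. z y * indicator (K y) x) \<partial>M)"
      by (simp add: nn_integral_sum nn_integral_cmult_indicator)
    also have "\<dots> \<le> (\<integral>\<^sup>+x. k n x \<partial>M)"
    proof (rule nn_integral_mono)
      fix x assume x: "x \<in> space M"
      \<comment> \<open>The sets \<open>K y\<close> lie in disjoint level sets, so only the summand
        for \<open>y = s x\<close> can be non-zero at \<open>x\<close>.\<close>
      have "(\<Sum>y\<in>Y. z y * indicator (K y) x) = (\<Sum>y\<in>{s x}. z y * indicator (K y) x)"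
        using K(2) x fin
        by (intro sum.mono_neutral_right) (fastforce simp: A_def Y_def indicator_def)+
      also have "\<dots> \<le> k n x"
        using elim x by (cases "x \<in> K (s x)") (auto simp: Y_def)
      finally show "(\<Sum>y\<in>Y. z y * indicator (K y) x) \<le> k n x" .
    qed
    finally show ?case using e(1) by simp
  qed
qed

text \<open>This turns upper semicontinuity of the extended integral into lower semicontinuity of a
  non-negative one, the form of \<open>eventually_less_nn_integral\<close>. The constant
  \<open>B\<close> integrates to itself because the total mass is 1.\<close>

lemma (in prob_space) ext_integral_bounded_above:
  assumes [measurable]: "f \<in> borel_measurable M"
    and B: "\<And>x. f x \<le> B" "B \<ge> 0"
  shows "ext_integral M f = ereal B - enn2ereal (\<integral>\<^sup>+x. ennreal (B - f x) \<partial>M)"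
proof -
  let ?p = "\<integral>\<^sup>+x. ennreal (f x) \<partial>M" and ?m = "\<integral>\<^sup>+x. ennreal (- f x) \<partial>M"
    and ?q = "\<integral>\<^sup>+x. ennreal (B - f x) \<partial>M"
  have pw: "ennreal (f x) + ennreal (B - f x) = ennreal B + ennreal (- f x)" for x
  proof (cases "f x \<ge> 0")
    case True
    then show ?thesis using B(1)[of x] by (simp add: ennreal_neg flip: ennreal_plus)
  next
    case False
    then show ?thesis using B by (simp add: ennreal_neg flip: ennreal_plus)
  qed
  have "?p + ?q = (\<integral>\<^sup>+x. ennreal (f x) + ennreal (B - f x) \<partial>M)"
    by (simp add: nn_integral_add)
  also have "\<dots> = ennreal B + ?m"
    unfolding pw by (simp add: nn_integral_add emeasure_space_1)
  finally have eq: "enn2ereal ?p + enn2ereal ?q = ereal B + enn2ereal ?m"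
    using B(2) by (metis enn2ereal_ennreal plus_ennreal.rep_eq)
  \<comment> \<open>Finiteness of \<open>?p\<close> permits subtracting it in \<open>eq\<close>;
    \<open>?q\<close> and \<open>?m\<close> may be infinite, but only together.\<close>
  have "?p \<le> (\<integral>\<^sup>+x. ennreal B \<partial>M)"
    using B by (intro nn_integral_mono ennreal_leI)
  then have "?p \<le> ennreal B" by (simp add: emeasure_space_1)
  then have "?p \<noteq> top" by (auto simp: top_unique)
  then obtain p where p: "?p = ennreal p" "p \<ge> 0" by (cases ?p) auto
  show ?thesis
    unfolding ext_integral_def using eq p
    by (cases "enn2ereal ?q"; cases "enn2ereal ?m") auto
qed

section \<open>The agent's choices and the principal's value\<close>

locale screening =
  fixes U V :: "'t::t2_space \<Rightarrow> 'c::t2_space \<Rightarrow> real"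
  assumes compact_contracts: "compact (UNIV :: 'c set)"
    and compact_types: "compact (UNIV :: 't set)"
    and continuous_U: "continuous_on UNIV (\<lambda>(\<theta>, c). U \<theta> c)"
    and usc_V: "usc (\<lambda>(\<theta>, c). V \<theta> c)"
begin

lemma continuous_U_section: "continuous_on S (U \<theta>)"
proof -
  have "continuous_on S (\<lambda>c. (\<lambda>(\<theta>, c). U \<theta> c) (\<theta>, c))"
    by (rule continuous_on_compose2[OF continuous_U]) (auto intro: continuous_intros)
  then show ?thesis by simp
qed

lemma open_U_less: "open {p. U (fst p) (snd p) < a}"
  and open_U_greater: "open {p. a < U (fst p) (snd p)}"
  using continuous_U
  by (auto intro!: open_Collect_less continuous_intros simp: case_prod_unfold)

lemma open_V_less: "open {p. V (fst p) (snd p) < a}"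
  using usc_V by (simp add: usc_def case_prod_unfold)

lemma mem_agent_choice_iff: "d \<in> agent_choice U \<theta> D \<longleftrightarrow> d \<in> D \<and> (\<forall>d'\<in>D. U \<theta> d' \<le> U \<theta> d)"
  by (auto simp: agent_choice_def is_arg_max_def not_less)

lemma agent_choice_nonempty:
  assumes "D \<in> menus"
  shows "agent_choice U \<theta> D \<noteq> {}"
proof -
  have "compact D"
    using assms closed_Int_compact[of D UNIV] compact_contracts by (auto simp: menus_def)
  then have "\<exists>d\<in>D. \<forall>d'\<in>D. U \<theta> d' \<le> U \<theta> d"
    using assms by (intro continuous_attains_sup continuous_U_section) (auto simp: menus_def)
  then show ?thesis
    using mem_agent_choice_iff by blast
qed

text \<open>The supremum is attained, at any element of
  \<open>agent_choice U \<theta> D\<close>.\<close>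

lemma le_agent_value_iff:
  assumes "D \<in> menus"
  shows "x \<le> agent_value U \<theta> D \<longleftrightarrow> (\<exists>d\<in>D. x \<le> U \<theta> d)"
proof -
  obtain d where "d \<in> agent_choice U \<theta> D"
    using agent_choice_nonempty[OF assms] by blast
  then have d: "d \<in> D" "\<And>d'. d' \<in> D \<Longrightarrow> U \<theta> d' \<le> U \<theta> d"
    by (simp_all add: mem_agent_choice_iff)
  then have "agent_value U \<theta> D = U \<theta> d"
    unfolding agent_value_def by (intro cSup_eq_maximum) auto
  with d show ?thesis by (auto intro: order_trans)
qed

text \<open>By upper semicontinuity \<open>V\<close> stays below its value at \<open>p\<close> plus
  1 near \<open>p\<close>, and bounds on two sets combine by \<open>max\<close>. The bound makes the
  real suprema in \<open>principal_value\<close> meaningful and supplies the constant for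
  \<open>ext_integral_bounded_above\<close>.\<close>

lemma V_bounded_above:
  "\<exists>B\<ge>0. \<forall>\<theta> c. V \<theta> c \<le> B"
proof -
  have "compact (UNIV :: ('t \<times> 'c) set)"
    using compact_Times[OF compact_types compact_contracts] by simp
  then obtain W where "(UNIV :: ('t \<times> 'c) set) \<subseteq> W" "\<exists>B. \<forall>p\<in>W. V (fst p) (snd p) \<le> B"
  proof (rule compact_neighbourhood_induct)
    show "\<exists>B. \<forall>p\<in>X \<union> Y. V (fst p) (snd p) \<le> B"
      if "\<exists>B. \<forall>p\<in>X. V (fst p) (snd p) \<le> B" "\<exists>B. \<forall>p\<in>Y. V (fst p) (snd p) \<le> B" for X Y
    proof -
      from that obtain B C where "\<forall>p\<in>X. V (fst p) (snd p) \<le> B" "\<forall>p\<in>Y. V (fst p) (snd p) \<le> C"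
        by blast
      then show ?thesis by (intro exI[of _ "max B C"]) auto
    qed
    show "\<exists>W. open W \<and> p \<in> W \<and> (\<exists>B. \<forall>p\<in>W. V (fst p) (snd p) \<le> B)" for p
      by (intro exI[of _ "{q. V (fst q) (snd q) < V (fst p) (snd p) + 1}"])
        (auto simp: open_V_less intro!: exI[of _ "V (fst p) (snd p) + 1"])
  qed auto
  then obtain B where "\<And>p. V (fst p) (snd p) \<le> B" by auto
  then show ?thesis
    by (intro exI[of _ "max 0 B"]) (auto simp: le_max_iff_disj)
qed

lemma principal_value_le:
  assumes "D \<in> menus" "\<And>d. d \<in> agent_choice U \<theta> D \<Longrightarrow> V \<theta> d \<le> a"
  shows "principal_value U V \<theta> D \<le> a"
  unfolding principal_value_def
  using assms agent_choice_nonempty by (intro cSUP_least) auto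

lemma le_principal_value:
  assumes "d \<in> agent_choice U \<theta> D"
  shows "V \<theta> d \<le> principal_value U V \<theta> D"
proof -
  obtain B where "\<And>\<theta> c. V \<theta> c \<le> B" using V_bounded_above by blast
  then show ?thesis
    unfolding principal_value_def by (intro cSUP_upper assms bdd_aboveI2)
qed

text \<open>Near \<open>\<theta>\<close> and for menus near \<open>D\<close>, contracts close to a suboptimal element of \<open>D\<close> are beaten by
  contracts close to an optimal one, so only contracts close to \<open>agent_choice U \<theta> D\<close> matter.\<close>
lemma principal_value_usc:
  assumes D: "D \<in> menus" and X: "\<And>n. X n \<in> menus" and lim: "vietoris_limit F X D"
    and a: "principal_value U V \<theta> D < a"
  shows "\<exists>W. open W \<and> \<theta> \<in> W \<and> (\<forall>\<^sub>F n in F. \<forall>\<theta>'\<in>W. principal_value U V \<theta>' (X n) \<le> a)"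
proof -
  \<comment> \<open>\<open>P G\<close> is the desired bound restricted to choices that fall in
    \<open>G\<close>. It is proved near each point of \<open>D\<close> and glued over the compact
    menu.\<close>
  define P where "P = (\<lambda>G. \<exists>W. open W \<and> \<theta> \<in> W \<and>
    (\<forall>\<^sub>F n in F. \<forall>\<theta>'\<in>W. \<forall>d\<in>agent_choice U \<theta>' (X n) \<inter> G. V \<theta>' d \<le> a))"
  obtain d0 where d0: "d0 \<in> agent_choice U \<theta> D"
    using agent_choice_nonempty[OF D] by blast
  have "compact D"
    using D closed_Int_compact[of D UNIV] compact_contracts by (auto simp: menus_def)
  then obtain G where G: "open G" "D \<subseteq> G" "P G"
  proof (rule compact_neighbourhood_induct)
    show "P {}" by (auto simp: P_def)
    show "P (A \<union> B)" if PA: "P A" and PB: "P B" for A B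
    proof -
      from PA obtain W1 where W1: "open W1" "\<theta> \<in> W1"
        "\<forall>\<^sub>F n in F. \<forall>\<theta>'\<in>W1. \<forall>d\<in>agent_choice U \<theta>' (X n) \<inter> A. V \<theta>' d \<le> a"
        unfolding P_def by blast
      from PB obtain W2 where W2: "open W2" "\<theta> \<in> W2"
        "\<forall>\<^sub>F n in F. \<forall>\<theta>'\<in>W2. \<forall>d\<in>agent_choice U \<theta>' (X n) \<inter> B. V \<theta>' d \<le> a"
        unfolding P_def by blast
      have "\<forall>\<^sub>F n in F. \<forall>\<theta>'\<in>W1 \<inter> W2. \<forall>d\<in>agent_choice U \<theta>' (X n) \<inter> (A \<union> B). V \<theta>' d \<le> a"
        using W1(3) W2(3) by eventually_elim blast
      then show ?thesis
        unfolding P_def using W1 W2 by (intro exI[of _ "W1 \<inter> W2"]) auto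
    qed
    fix d assume d: "d \<in> D"
    show "\<exists>G. open G \<and> d \<in> G \<and> P G"
    proof (cases "d \<in> agent_choice U \<theta> D")
      case True
      then have "(\<theta>, d) \<in> {p. V (fst p) (snd p) < a}"
        using le_principal_value a by fastforce
      then obtain W G where "open W" "open G" "(\<theta>, d) \<in> W \<times> G"
          "W \<times> G \<subseteq> {p. V (fst p) (snd p) < a}"
        by (rule open_prod_elim[OF open_V_less])
      moreover from this have "V \<theta>' d' \<le> a" if "\<theta>' \<in> W" "d' \<in> G" for \<theta>' d'
        using that by (auto intro: less_imp_le)
      ultimately show ?thesis
        unfolding P_def by (intro exI[of _ G] conjI exI[of _ W]) auto
    next
      case False
      then have "U \<theta> d < U \<theta> d0"
        using d d0 by (force simp: mem_agent_choice_iff not_le)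
      \<comment> \<open>The level \<open>m\<close> separates the two utilities. Near \<theta>,
        contracts in \<open>G1\<close> yield less than \<open>m\<close> and those in
        \<open>G2\<close> more; eventually \<open>X n\<close> offers one from \<open>G2\<close>, so
        nothing in \<open>G1\<close> is chosen and \<open>P G1\<close> holds vacuously.\<close>
      then obtain m where m: "U \<theta> d < m" "m < U \<theta> d0" using dense by blast
      obtain W1 G1 where 1: "open W1" "open G1" "(\<theta>, d) \<in> W1 \<times> G1"
          "W1 \<times> G1 \<subseteq> {p. U (fst p) (snd p) < m}"
        using m(1) by (elim open_prod_elim[OF open_U_less, of "(\<theta>, d)" m, rotated]) auto
      obtain W2 G2 where 2: "open W2" "open G2" "(\<theta>, d0) \<in> W2 \<times> G2"
          "W2 \<times> G2 \<subseteq> {p. m < U (fst p) (snd p)}"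
        using m(2) by (elim open_prod_elim[OF open_U_greater, of "(\<theta>, d0)" m, rotated]) auto
      have "D \<inter> G2 \<noteq> {}" using d0 2(3) mem_agent_choice_iff by auto
      then have "\<forall>\<^sub>F n in F. X n \<inter> G2 \<noteq> {}"
        using lim 2(2) unfolding vietoris_limit_def by blast
      then have "\<forall>\<^sub>F n in F. \<forall>\<theta>'\<in>W1 \<inter> W2. agent_choice U \<theta>' (X n) \<inter> G1 = {}"
      proof eventually_elim
        case (elim n)
        then obtain e where e: "e \<in> X n" "e \<in> G2" by blast
        have "d' \<notin> agent_choice U \<theta>' (X n)" if "\<theta>' \<in> W1 \<inter> W2" "d' \<in> G1" for \<theta>' d'
        proof -
          have "U \<theta>' d' < m" using that 1(4) by auto
          also have "m < U \<theta>' e" using that e 2(4) by auto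
          finally show ?thesis using e(1) by (auto simp: mem_agent_choice_iff not_le)
        qed
        then show ?case by blast
      qed
      then have "\<forall>\<^sub>F n in F. \<forall>\<theta>'\<in>W1 \<inter> W2. \<forall>d\<in>agent_choice U \<theta>' (X n) \<inter> G1. V \<theta>' d \<le> a"
        by eventually_elim blast
      then show ?thesis
        unfolding P_def using 1 2
        by (intro exI[of _ G1] conjI exI[of _ "W1 \<inter> W2"]) auto
    qed
  qed
  from G(3) obtain W where W: "open W" "\<theta> \<in> W"
    "\<forall>\<^sub>F n in F. \<forall>\<theta>'\<in>W. \<forall>d\<in>agent_choice U \<theta>' (X n) \<inter> G. V \<theta>' d \<le> a"
    unfolding P_def by blast
  \<comment> \<open>By the upper half of the limit, all choices from \<open>X n\<close> fall in
    \<open>G\<close>, so the restriction in \<open>P G\<close> disappears.\<close>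
  have "\<forall>\<^sub>F n in F. X n \<subseteq> G"
    using lim G(1,2) unfolding vietoris_limit_def by blast
  with W(3) have "\<forall>\<^sub>F n in F. \<forall>\<theta>'\<in>W. principal_value U V \<theta>' (X n) \<le> a"
  proof eventually_elim
    case (elim n)
    then show ?case
      by (intro ballI principal_value_le[OF X]) (auto simp: mem_agent_choice_iff)
  qed
  with W show ?thesis by blast
qed

section \<open>Semicontinuity of the payoff and closedness of the constraint\<close>

text \<open>For a constant sequence of menus, \<open>principal_value_usc\<close> says that the value
  is upper semicontinuous in the type. The intermediate \<open>b\<close> turns its non-strict bound
  into a strict one.\<close>

lemma borel_measurable_principal_value:
  assumes D: "D \<in> menus"
  shows "(\<lambda>\<theta>. principal_value U V \<theta> D) \<in> borel_measurable borel"
proof -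
  have "open {\<theta>. principal_value U V \<theta> D < a}" for a
  proof (subst open_subopen, safe)
    fix \<theta> assume "principal_value U V \<theta> D < a"
    then obtain b where b: "principal_value U V \<theta> D < b" "b < a" using dense by blast
    obtain W where "open W" "\<theta> \<in> W" "\<forall>\<theta>'\<in>W. principal_value U V \<theta>' D \<le> b"
      using principal_value_usc[OF D D vietoris_limit_const[of sequentially] b(1)] by auto
    then show "\<exists>W. open W \<and> \<theta> \<in> W \<and> W \<subseteq> {\<theta>. principal_value U V \<theta> D < a}"
      using b(2) by (intro exI[of _ W]) fastforce
  qed
  then show ?thesis
    by (auto simp: borel_measurable_iff_less)
qed

text \<open>The integral is \<open>B\<close> minus the integral \<open>N\<close> of the gap.
  \<open>N\<close> is lower semicontinuous along \<open>F\<close> by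
  \<open>eventually_less_nn_integral\<close>, whose local hypothesis is
  \<open>principal_value_usc\<close>.\<close>

lemma ext_integral_principal_value_usc:
  assumes reg: "regular_borel_prob \<kappa>"
    and D: "D \<in> menus" and X: "\<And>n. X n \<in> menus" and lim: "vietoris_limit F X D"
    and "F \<noteq> bot"
    and ge: "\<forall>\<^sub>F n in F. b \<le> ext_integral \<kappa> (\<lambda>\<theta>. principal_value U V \<theta> (X n))"
  shows "b \<le> ext_integral \<kappa> (\<lambda>\<theta>. principal_value U V \<theta> D)"
proof -
  interpret prob_space \<kappa> using reg by (simp add: regular_borel_prob_def)
  have sets: "sets \<kappa> = sets borel" using reg by (simp add: regular_borel_prob_def)
  obtain B where B: "B \<ge> 0" "\<And>\<theta> c. V \<theta> c \<le> B" using V_bounded_above by blast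
  define N where "N = (\<lambda>E. \<integral>\<^sup>+\<theta>. ennreal (B - principal_value U V \<theta> E) \<partial>\<kappa>)"
  have pvB: "principal_value U V \<theta> E \<le> B" if "E \<in> menus" for \<theta> E
    using that B(2) by (rule principal_value_le)
  have ext: "ext_integral \<kappa> (\<lambda>\<theta>. principal_value U V \<theta> E) = ereal B - enn2ereal (N E)"
    if "E \<in> menus" for E
    unfolding N_def
  proof (rule ext_integral_bounded_above)
    show "(\<lambda>\<theta>. principal_value U V \<theta> E) \<in> borel_measurable \<kappa>"
      using borel_measurable_principal_value[OF that] by (simp add: measurable_cong_sets[OF sets refl])
  qed (use that pvB B in auto)
  show ?thesis
  proof (rule ccontr)
    assume "\<not> ?thesis"
    then have *: "ereal B - enn2ereal (N D) < b" by (simp add: ext[OF D])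
    have "\<forall>\<^sub>F n in F. b \<le> ereal B"
      using ge
    proof eventually_elim
      case (elim n)
      also have "ext_integral \<kappa> (\<lambda>\<theta>. principal_value U V \<theta> (X n)) \<le> ereal B - 0"
        unfolding ext[OF X] by (intro ereal_minus_mono) auto
      finally show ?case by simp
    qed
    \<comment> \<open>Together with \<open>b \<noteq> -\<infinity>\<close> this makes
      \<open>b\<close> a real \<open>r\<close>, so that a failure at \<open>D\<close> reads
      \<open>N D > B - r\<close> in \<open>ennreal\<close>; some \<open>c\<close> strictly in
      between is then eventually exceeded by \<open>N (X n)\<close>, against
      \<open>ge\<close>.\<close>
    then have "b \<le> ereal B" using \<open>F \<noteq> bot\<close> by simp
    moreover have "b \<noteq> -\<infinity>" using * by auto
    ultimately obtain r where r: "b = ereal r" "r \<le> B" by (cases b) auto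
    have "ennreal (B - r) < N D"
      using * r by (cases "N D") (auto simp: ennreal_less_iff)
    then obtain c where c: "ennreal (B - r) < c" "c < N D" using dense by blast
    then have "ereal B - enn2ereal c < b"
      using r by (cases c) (auto simp: ennreal_less_iff)
    with c have "\<exists>c. c < N D \<and> ereal B - enn2ereal c < b" by blast
    then obtain c where c: "c < N D" "ereal B - enn2ereal c < b" by blast
    have "\<forall>\<^sub>F n in F. c < N (X n)"
      unfolding N_def
    proof (rule eventually_less_nn_integral[OF reg _ c(1)[unfolded N_def]])
      fix \<theta> and x :: ennreal
      assume x: "x < ennreal (B - principal_value U V \<theta> D)"
      then obtain y where y: "x = ennreal y" "y \<ge> 0" by (cases x) auto
      with x have "principal_value U V \<theta> D < B - y" by (auto simp: ennreal_less_iff)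
      from principal_value_usc[OF D X lim this]
      obtain W where W: "open W" "\<theta> \<in> W"
        "\<forall>\<^sub>F n in F. \<forall>\<theta>'\<in>W. principal_value U V \<theta>' (X n) \<le> B - y" by blast
      have "\<forall>\<^sub>F n in F. \<forall>\<theta>'\<in>W. x \<le> ennreal (B - principal_value U V \<theta>' (X n))"
        using W(3) by eventually_elim (auto simp: y intro!: ennreal_leI)
      with W show "\<exists>W. open W \<and> \<theta> \<in> W \<and>
          (\<forall>\<^sub>F n in F. \<forall>\<theta>'\<in>W. x \<le> ennreal (B - principal_value U V \<theta>' (X n)))" by blast
    qed
    with ge have "\<forall>\<^sub>F n in F. False"
    proof eventually_elim
      case (elim n)
      have "b \<le> ereal B - enn2ereal (N (X n))" using elim by (simp add: ext[OF X])
      also have "\<dots> \<le> ereal B - enn2ereal c"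
        using elim by (intro ereal_minus_mono) (auto simp: less_eq_ennreal.rep_eq[symmetric])
      finally show ?case using c(2) by simp
    qed
    then show False using \<open>F \<noteq> bot\<close> by (simp add: trivial_limit_def)
  qed
qed

text \<open>An infimum of upper semicontinuous functions is upper semicontinuous: the bound
  \<open>b\<close> is checked for each belief, and the finite penalty moves across the
  inequality.\<close>

lemma robust_payoff_usc:
  assumes reg: "\<forall>\<kappa>\<in>\<K>. regular_borel_prob \<kappa>"
    and D: "D \<in> menus" and X: "\<And>n. X n \<in> menus" and lim: "vietoris_limit F X D"
    and "F \<noteq> bot"
    and ge: "\<forall>\<^sub>F n in F. b \<le> robust_payoff U V \<K> \<alpha> (X n)"
  shows "b \<le> robust_payoff U V \<K> \<alpha> D"
  unfolding robust_payoff_def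
proof (rule INF_greatest)
  fix \<kappa> assume \<kappa>: "\<kappa> \<in> \<K>"
  have "\<forall>\<^sub>F n in F. b - ereal (\<alpha> \<kappa>) \<le> ext_integral \<kappa> (\<lambda>\<theta>. principal_value U V \<theta> (X n))"
    using ge
  proof eventually_elim
    case (elim n)
    also have "robust_payoff U V \<K> \<alpha> (X n)
        \<le> ext_integral \<kappa> (\<lambda>\<theta>. principal_value U V \<theta> (X n)) + ereal (\<alpha> \<kappa>)"
      unfolding robust_payoff_def using \<kappa> by (rule INF_lower)
    finally show ?case by (simp add: ereal_minus_le_iff add.commute)
  qed
  then have "b - ereal (\<alpha> \<kappa>) \<le> ext_integral \<kappa> (\<lambda>\<theta>. principal_value U V \<theta> D)"
    using reg \<kappa> by (intro ext_integral_principal_value_usc[OF _ D X lim \<open>F \<noteq> bot\<close>]) auto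
  then show "b \<le> ext_integral \<kappa> (\<lambda>\<theta>. principal_value U V \<theta> D) + ereal (\<alpha> \<kappa>)"
    by (simp add: ereal_minus_le_iff add.commute)
qed

text \<open>If \<open>D\<close> failed at \<theta>, it would lie in the open set \<open>?W\<close>
  of contracts worth less than \<open>u \<theta>\<close>, and so would \<open>X n\<close>
  eventually; but each \<open>X n\<close> attains at least \<open>u \<theta>\<close>.\<close>

lemma ir_menus_vietoris_closed:
  assumes D: "D \<in> menus" and X: "\<And>n. X n \<in> ir_menus U u"
    and lim: "vietoris_limit F X D" and "F \<noteq> bot"
  shows "D \<in> ir_menus U u"
proof -
  have "u \<theta> \<le> agent_value U \<theta> D" for \<theta>
  proof (rule ccontr)
    let ?W = "{d. U \<theta> d < u \<theta>}"
    assume "\<not> ?thesis"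
    then have "D \<subseteq> ?W" by (auto simp: le_agent_value_iff[OF D])
    moreover have "open ?W"
      by (intro open_Collect_less continuous_U_section continuous_intros)
    ultimately have "\<forall>\<^sub>F n in F. X n \<subseteq> ?W"
      using lim unfolding vietoris_limit_def by blast
    moreover have "\<not> X n \<subseteq> ?W" for n
      using X[of n] le_agent_value_iff[of "X n" "u \<theta>" \<theta>] by (force simp: ir_menus_def)
    ultimately show False using \<open>F \<noteq> bot\<close> by (simp add: trivial_limit_def)
  qed
  with D show ?thesis by (simp add: ir_menus_def)
qed

end

section \<open>Existence of an optimal menu\<close>

theorem theorem3:
  fixes U V :: "'t::t2_space \<Rightarrow> 'c::t2_space \<Rightarrow> real"
    and u :: "'t \<Rightarrow> real"
    and \<K> :: "'t measure set"
    and \<alpha> :: "'t measure \<Rightarrow> real"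
  assumes "compact (UNIV :: 'c set)"
    and "compact (UNIV :: 't set)"
    and "continuous_on UNIV (\<lambda>(\<theta>, c). U \<theta> c)"
    and "usc (\<lambda>(\<theta>, c). V \<theta> c)"
    and "\<exists>c. \<forall>\<theta>. U \<theta> c \<ge> u \<theta>"
    and "\<K> \<noteq> {}"
    and "\<forall>\<kappa>\<in>\<K>. regular_borel_prob \<kappa>"
  shows "\<exists>D\<in>ir_menus U u.
           robust_payoff U V \<K> \<alpha> D = (SUP D'\<in>ir_menus U u. robust_payoff U V \<K> \<alpha> D')"
proof -
  interpret screening U V using assms(1-4) by unfold_locales
  let ?R = "robust_payoff U V \<K> \<alpha>" and ?T = "ir_menus U u"
  obtain c where "\<forall>\<theta>. U \<theta> c \<ge> u \<theta>" using assms(5) by blast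
  \<comment> \<open>The singleton menu of the given contract shows that the feasible set is
    non-empty.\<close>
  then have "{c} \<in> ?T" by (auto simp: ir_menus_def menus_def agent_value_def)
  then have "?R ` ?T \<noteq> {}" by blast
  from Sup_countable_SUP[OF this] obtain r :: "nat \<Rightarrow> ereal"
    where r: "incseq r" "range r \<subseteq> ?R ` ?T" "(SUP D\<in>?T. ?R D) = (SUP n. r n)" by auto
  then have "\<forall>n. \<exists>D\<in>?T. r n = ?R D" by blast
  then obtain X where X: "\<And>n. X n \<in> ?T" "\<And>n. r n = ?R (X n)" by metis
  have menu: "X n \<in> menus" for n using X(1) by (simp add: ir_menus_def)
  obtain F :: "nat filter" where F: "F \<le> sequentially" "F \<noteq> bot"
    "\<And>P. eventually P F \<or> eventually (\<lambda>n. \<not> P n) F"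
    using ultrafilter_below[OF sequentially_bot] by metis
  obtain D where D: "D \<in> menus" and lim: "vietoris_limit F X D"
    using vietoris_limit_exists[OF assms(1) F(2,3), of X] menu by (auto simp: menus_def)
  have "D \<in> ?T" using ir_menus_vietoris_closed[OF D X(1) lim F(2)] .
  \<comment> \<open>Since \<open>F\<close> refines \<open>sequentially\<close> and \<open>r\<close>
    increases, \<open>r m\<close> eventually bounds the payoffs of \<open>X n\<close> from below;
    semicontinuity passes this to \<open>D\<close>.\<close>
  moreover have "r m \<le> ?R D" for m
  proof (rule robust_payoff_usc[OF assms(7) D menu lim F(2)])
    show "\<forall>\<^sub>F n in F. r m \<le> ?R (X n)"
      using filter_leD[OF F(1) eventually_ge_at_top[of m]]
      by eventually_elim (simp add: X(2)[symmetric] incseqD[OF r(1)])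
  qed
  then have "(SUP D\<in>?T. ?R D) \<le> ?R D"
    unfolding r(3) by (rule SUP_least)
  ultimately have "?R D = (SUP D\<in>?T. ?R D)"
    by (intro antisym SUP_upper)
  with \<open>D \<in> ?T\<close> show ?thesis by blast
qed

end
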